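(* Let $Z\in\mathbb{R}^{N\times N}$, let $K\in[1,N]$ be an integer, let $\tau>0$ and $\rho>6N\tau$, and let $\{(X^{(t)},Y^{(t)},\Lambda^{(t)})\}$ be the sequence generated by the NS-SymNMF algorithm (defined in the context), with $\mathcal{P}$ and $\mathcal{L}$ as defined in the context. For a given small constant $\epsilon$, let $T(\epsilon)$ denote the iteration index $$T(\epsilon)=\min\{t \mid \mathcal{P}(X^{(t)},Y^{(t)},\Lambda^{(t)})\le\epsilon,\ t\ge0\}.$$ Then there exists some constant $C>0$ such that $$\epsilon\le\frac{C\,\mathcal{L}(X^{(1)},Y^{(1)},\Lambda^{(1)})}{T(\epsilon)} .$$
   Context: Matrices are real; $\|\cdot\|_F$ is the Frobenius norm, $\langle\cdot,\cdot\rangle$ the corresponding inner product; $\ge0$ for matrices is entrywise; $Y_i$ is the $i$th row of $Y$. $Z$ is not assumed symmetric, positive semidefinite, or to have positive entries. NS-SymNMF algorithm with parameters $\rho>0,\tau>0$: from an initial point $X^{(0)},Y^{(0)},\Lambda^{(0)}\in\mathbb{R}^{N\times K}$ and $\beta^{(0)}\ge0$, iterate $$Y^{(t+1)}=\arg\min_{Y\ge0,\ \|Y_i\|_2^2\le\tau\ \forall i}\ \tfrac12\|X^{(t)}Y^T-Z\|_F^2+\tfrac{\rho}{2}\|Y-X^{(t)}+\Lambda^{(t)}/\rho\|_F^2+\tfrac{\beta^{(t)}}{2}\|Y-Y^{(t)}\|_F^2,$$ $$X^{(t+1)}=\arg\min_{X}\ \tfrac12\|X(Y^{(t+1)})^T-Z\|_F^2+\tfrac{\rho}{2}\|X-\Lambda^{(t)}/\rho-Y^{(t+1)}\|_F^2,$$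 $$\Lambda^{(t+1)}=\Lambda^{(t)}+\rho(Y^{(t+1)}-X^{(t+1)}),\qquad \beta^{(t+1)}=\tfrac{6}{\rho}\|X^{(t+1)}(Y^{(t+1)})^T-Z\|_F^2 .$$ Augmented Lagrangian: $\mathcal{L}(X,Y,\Lambda)=\frac12\|XY^T-Z\|_F^2+\langle Y-X,\Lambda\rangle+\frac{\rho}{2}\|Y-X\|_F^2$ for $X,Y,\Lambda\in\mathbb{R}^{N\times K}$. Feasible set: $\mathcal{Y}=\{Y\in\mathbb{R}^{N\times K}\mid Y\ge0,\ \|Y_i\|_2^2\le\tau\ \forall i\}$, and $\mathrm{proj}_{\mathcal{Y}}(W)=\arg\min_{Y\in\mathcal{Y}}\|W-Y\|_F^2$. Optimality measure: $$\mathcal{P}(X,Y,\Lambda)=\big\|Y-\mathrm{proj}_{\mathcal{Y}}[Y-\nabla_Y\mathcal{L}(X,Y,\Lambda)]\big\|_F^2+\|\nabla_X\mathcal{L}(X,Y,\Lambda)\|_F^2+\|X-Y\|_F^2 .$$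
   Formalization: The inequality is claimed only when T(ε) ≥ 1 (otherwise it divides by zero) and not when T(ε) = 1 with L(X^(1),Y^(1),Λ^(1)) = 0, where it would read ε ≤ 0 and is false (e.g. N=K=1, Z=0, τ=1, ρ=7, X^(0)=Λ^(0)=0, Y^(0)=1, β^(0)=0). *)

theory Defs
  imports "HOL-Analysis.Analysis"
begin

text \<open>
  An \<open>N \<times> K\<close> matrix is an element of \<^typ>\<open>real^'k^'n\<close> with \<open>N = CARD('n)\<close> and
  \<open>K = CARD('k)\<close>; \<open>Y $ i\<close> is its \<open>i\<close>th row. On this type the library's \<^const>\<open>norm\<close> and
  \<^const>\<open>inner\<close> are the Frobenius norm and the Frobenius inner product.
\<close>

definition aug_lagrangian ::
    "real^'n^'n \<Rightarrow> real \<Rightarrow> real^'k^'n \<Rightarrow> real^'k^'n \<Rightarrow> real^'k^'n \<Rightarrow> real" where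
  "aug_lagrangian Z \<rho> X Y \<Lambda> =
     1/2 * (norm (X ** transpose Y - Z))\<^sup>2 + inner (Y - X) \<Lambda> + \<rho>/2 * (norm (Y - X))\<^sup>2"

definition feasible_set :: "real \<Rightarrow> (real^'k^'n) set" where
  "feasible_set \<tau> = {Y. (\<forall>i j. 0 \<le> Y $ i $ j) \<and> (\<forall>i. (norm (Y $ i))\<^sup>2 \<le> \<tau>)}"

definition proj_feasible :: "real \<Rightarrow> real^'k^'n \<Rightarrow> real^'k^'n" where
  "proj_feasible \<tau> W = (ARG_MIN (\<lambda>Y. (norm (W - Y))\<^sup>2) Y. Y \<in> feasible_set \<tau>)"

definition grad :: "('a::real_inner \<Rightarrow> real) \<Rightarrow> 'a \<Rightarrow> 'a" where
  "grad f x = (THE D. GDERIV f x :> D)"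

definition opt_measure ::
    "real^'n^'n \<Rightarrow> real \<Rightarrow> real \<Rightarrow> real^'k^'n \<Rightarrow> real^'k^'n \<Rightarrow> real^'k^'n \<Rightarrow> real" where
  "opt_measure Z \<rho> \<tau> X Y \<Lambda> =
     (norm (Y - proj_feasible \<tau> (Y - grad (\<lambda>Y'. aug_lagrangian Z \<rho> X Y' \<Lambda>) Y)))\<^sup>2
     + (norm (grad (\<lambda>X'. aug_lagrangian Z \<rho> X' Y \<Lambda>) X))\<^sup>2
     + (norm (X - Y))\<^sup>2"

text \<open>
  The initial point \<open>X 0\<close>, \<open>Y 0\<close>, \<open>\<Lambda> 0\<close> is arbitrary; in particular \<open>Y 0\<close> need not be feasible.
\<close>

definition ns_symnmf ::
    "real^'n^'n \<Rightarrow> real \<Rightarrow> real \<Rightarrow> (nat \<Rightarrow> real^'k^'n) \<Rightarrow> (nat \<Rightarrow> real^'k^'n)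
      \<Rightarrow> (nat \<Rightarrow> real^'k^'n) \<Rightarrow> (nat \<Rightarrow> real) \<Rightarrow> bool" where
  "ns_symnmf Z \<rho> \<tau> X Y \<Lambda> \<beta> \<longleftrightarrow>
     0 \<le> \<beta> 0 \<and>
     (\<forall>t.
       is_arg_min
         (\<lambda>V. 1/2 * (norm (X t ** transpose V - Z))\<^sup>2
            + \<rho>/2 * (norm (V - X t + \<Lambda> t /\<^sub>R \<rho>))\<^sup>2
            + \<beta> t / 2 * (norm (V - Y t))\<^sup>2)
         (\<lambda>V. V \<in> feasible_set \<tau>) (Y (Suc t)) \<and>
       is_arg_min
         (\<lambda>U. 1/2 * (norm (U ** transpose (Y (Suc t)) - Z))\<^sup>2
            + \<rho>/2 * (norm (U - \<Lambda> t /\<^sub>R \<rho> - Y (Suc t)))\<^sup>2)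
         (\<lambda>U. True) (X (Suc t)) \<and>
       \<Lambda> (Suc t) = \<Lambda> t + \<rho> *\<^sub>R (Y (Suc t) - X (Suc t)) \<and>
       \<beta> (Suc t) = 6 / \<rho> * (norm (X (Suc t) ** transpose (Y (Suc t)) - Z))\<^sup>2)"

definition iter_index ::
    "real^'n^'n \<Rightarrow> real \<Rightarrow> real \<Rightarrow> (nat \<Rightarrow> real^'k^'n) \<Rightarrow> (nat \<Rightarrow> real^'k^'n)
      \<Rightarrow> (nat \<Rightarrow> real^'k^'n) \<Rightarrow> real \<Rightarrow> nat" where
  "iter_index Z \<rho> \<tau> X Y \<Lambda> \<epsilon> = (LEAST t. opt_measure Z \<rho> \<tau> (X t) (Y t) (\<Lambda> t) \<le> \<epsilon>)"

end

theory Submission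
  imports Defs
begin

text \<open>
  Write \<open>R = X Y\<^sup>T - Z\<close>. From the first iteration on, optimality of the \<open>X\<close>-step says \<open>\<Lambda> = R Y\<close>.
  Hence a change of the multiplier is controlled by the changes \<open>\<Delta>X\<close>, \<open>\<Delta>Y\<close> of the primal variables,
  and since \<open>\<rho> > 6 N \<tau>\<close> and \<open>\<beta> = 6 |R|\<^sup>2 / \<rho>\<close>, the increase \<open>|\<Delta>\<Lambda>|\<^sup>2 / \<rho>\<close> of the augmented Lagrangian
  in the multiplier step is dominated by the decrease in the two (strongly convex quadratic) primal
  steps; each iteration decreases it by at least \<open>\<rho>/2 (|\<Delta>X|\<^sup>2 + |\<Delta>Y|\<^sup>2)\<close>. The identity \<open>\<Lambda> = R Y\<close> also
  gives a nonnegative lower bound, which makes the iterates bounded. The optimality measure at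
  iterate \<open>t + 1\<close> is \<open>O(|\<Delta>X|\<^sup>2 + |\<Delta>Y|\<^sup>2)\<close>, so it is summable with sum \<open>O(\<L>\<^sub>1)\<close>. Its value at
  iterate 1 is not covered by the descent (\<open>Y\<^sub>0\<close> may be infeasible and \<open>\<Lambda>\<^sub>0\<close> arbitrary) and is
  bounded by \<open>\<L>\<^sub>1\<close> directly, through the lower bound.
\<close>

section \<open>Frobenius norm and matrix products\<close>

lemma norm_matrix_power2:
  fixes A :: "real^'m^'n"
  shows "(norm A)\<^sup>2 = (\<Sum>i\<in>UNIV. (norm (A $ i))\<^sup>2)"
  by (simp add: power2_norm_eq_inner inner_vec_def)

lemma inner_transpose_transpose:
  fixes A B :: "real^'m^'n"
  shows "inner (transpose A) (transpose B) = inner A B"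
  by (simp add: inner_vec_def transpose_def) (rule sum.swap)

lemma norm_transpose [simp]:
  fixes A :: "real^'m^'n"
  shows "norm (transpose A) = norm A"
  by (simp add: norm_eq_sqrt_inner inner_transpose_transpose)

lemma inner_matrix_mult_left:
  fixes A :: "real^'m^'n" and B :: "real^'p^'m" and C :: "real^'p^'n"
  shows "inner (A ** B) C = inner A (C ** transpose B)"
proof -
  have "(\<Sum>j\<in>UNIV. (\<Sum>k\<in>UNIV. A $ i $ k * B $ k $ j) * C $ i $ j) =
        (\<Sum>k\<in>UNIV. A $ i $ k * (\<Sum>j\<in>UNIV. C $ i $ j * B $ k $ j))" for i
    unfolding sum_distrib_left sum_distrib_right
    by (subst sum.swap) (simp add: mult_ac)
  then show ?thesis
    by (simp add: inner_vec_def matrix_matrix_mult_def transpose_def)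
qed

text \<open>Each entry of the product pairs a row of \<open>A\<close> with a column of
  \<open>B\<close>; Cauchy-Schwarz bounds its square, and the double sum then factorises.\<close>

lemma norm_matrix_mult_le:
  fixes A :: "real^'m^'n" and B :: "real^'p^'m"
  shows "norm (A ** B) \<le> norm A * norm B"
proof -
  have entry: "(A ** B) $ i $ j = inner (A $ i) (transpose B $ j)" for i j
    by (simp add: matrix_matrix_mult_def transpose_def inner_vec_def)
  have row: "(norm ((A ** B) $ i))\<^sup>2 = (\<Sum>j\<in>UNIV. (inner (A $ i) (transpose B $ j))\<^sup>2)" for i
    by (subst power2_norm_eq_inner) (simp add: inner_vec_def[of "(A ** B) $ i"] entry power2_eq_square)
  have "(norm (A ** B))\<^sup>2 = (\<Sum>i\<in>UNIV. \<Sum>j\<in>UNIV. (inner (A $ i) (transpose B $ j))\<^sup>2)"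
    by (simp only: norm_matrix_power2 row)
  also have "\<dots> \<le> (\<Sum>i\<in>UNIV. \<Sum>j\<in>UNIV. (norm (A $ i))\<^sup>2 * (norm (transpose B $ j))\<^sup>2)"
    by (intro sum_mono) (metis Cauchy_Schwarz_ineq power2_norm_eq_inner)
  also have "\<dots> = (norm A)\<^sup>2 * (norm (transpose B))\<^sup>2"
    by (simp only: norm_matrix_power2[of A] norm_matrix_power2[of "transpose B"] sum_product)
  also have "\<dots> = (norm A * norm B)\<^sup>2"
    by (simp add: power_mult_distrib)
  finally show ?thesis
    by (rule power2_le_imp_le) simp
qed

lemma bounded_bilinear_matrix_mult:
  "bounded_bilinear (\<lambda>(A::real^'m^'n) (B::real^'p^'m). A ** B)"
proof
  show "\<exists>K. \<forall>(A::real^'m^'n) (B::real^'p^'m). norm (A ** B) \<le> norm A * norm B * K"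
    by (rule exI[of _ 1]) (simp add: norm_matrix_mult_le)
qed (vector matrix_matrix_mult_def sum.distrib sum_distrib_left algebra_simps)+

lemmas matrix_mult_add_left = bounded_bilinear.add_left[OF bounded_bilinear_matrix_mult]
  and matrix_mult_diff_left = bounded_bilinear.diff_left[OF bounded_bilinear_matrix_mult]
  and matrix_mult_diff_right = bounded_bilinear.diff_right[OF bounded_bilinear_matrix_mult]
  and matrix_mult_scaleR_left = bounded_bilinear.scaleR_left[OF bounded_bilinear_matrix_mult]

lemma transpose_diff: "transpose (A - B) = transpose A - transpose (B :: real^'m^'n)"
  by (simp add: transpose_def vec_eq_iff)


section \<open>Exact quadratic expansions\<close>

text \<open>Exact second-order expansion at \<open>x\<close>: \<open>g\<close> is the gradient and
  \<open>q\<close> half the Hessian form. Exactness lets one fact yield the gradient, the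
  first-order condition and the precise decrease of a minimisation step.\<close>

definition quad_expansion ::
    "('a::real_inner \<Rightarrow> real) \<Rightarrow> 'a \<Rightarrow> 'a \<Rightarrow> ('a \<Rightarrow> real) \<Rightarrow> bool" where
  "quad_expansion f x g q \<longleftrightarrow>
     (\<forall>h. f (x + h) = f x + inner g h + q h) \<and>
     (\<forall>s h. q (s *\<^sub>R h) = s\<^sup>2 * q h) \<and>
     (\<exists>c. \<forall>h. \<bar>q h\<bar> \<le> c * (norm h)\<^sup>2)"

lemma quad_expansionD:
  assumes "quad_expansion f x g q"
  shows "f y = f x + inner g (y - x) + q (y - x)"
  using assms unfolding quad_expansion_def by (metis add_diff_cancel_left' add.commute diff_add_cancel)

lemma quad_expansion_add:
  assumes "quad_expansion f1 x g1 q1" "quad_expansion f2 x g2 q2"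
  shows "quad_expansion (\<lambda>x. f1 x + f2 x) x (g1 + g2) (\<lambda>h. q1 h + q2 h)"
proof -
  obtain c1 c2 where c: "\<bar>q1 h\<bar> \<le> c1 * (norm h)\<^sup>2" "\<bar>q2 h\<bar> \<le> c2 * (norm h)\<^sup>2" for h
    using assms unfolding quad_expansion_def by blast
  have "\<bar>q1 h + q2 h\<bar> \<le> (c1 + c2) * (norm h)\<^sup>2" for h
    using c[of h] by (simp add: distrib_right)
  then show ?thesis
    using assms unfolding quad_expansion_def by (auto simp: inner_add_left distrib_left)
qed

lemma quad_expansion_inner_diff: "quad_expansion (\<lambda>x. inner (x - b) a) x a (\<lambda>h. 0)"
  unfolding quad_expansion_def by (auto simp: inner_simps inner_commute intro!: exI[of _ 0])

lemma quad_expansion_norm: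
  "quad_expansion (\<lambda>x. c / 2 * (norm (x - a))\<^sup>2) x (c *\<^sub>R (x - a)) (\<lambda>h. c / 2 * (norm h)\<^sup>2)"
  unfolding quad_expansion_def
proof (intro conjI allI exI[of _ "\<bar>c / 2\<bar>"])
  fix h
  show "c / 2 * (norm (x + h - a))\<^sup>2
      = c / 2 * (norm (x - a))\<^sup>2 + inner (c *\<^sub>R (x - a)) h + c / 2 * (norm h)\<^sup>2"
    by (simp add: power2_norm_eq_inner inner_simps inner_commute algebra_simps)
qed (auto simp: power_mult_distrib abs_mult)

lemma quad_expansion_residual_left:
  fixes Z :: "real^'m^'n" and B :: "real^'k^'m" and U :: "real^'k^'n"
  shows "quad_expansion (\<lambda>U. 1/2 * (norm (U ** transpose B - Z))\<^sup>2) U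
     ((U ** transpose B - Z) ** B) (\<lambda>h. 1/2 * (norm (h ** transpose B))\<^sup>2)"
  unfolding quad_expansion_def
proof (intro conjI allI exI[of _ "1/2 * (norm B)\<^sup>2"])
  fix h :: "real^'k^'n"
  define R where "R = U ** transpose B - Z"
  have "(U + h) ** transpose B - Z = R + h ** transpose B"
    by (simp add: R_def matrix_mult_add_left)
  moreover have "inner (h ** transpose B) R = inner h (R ** B)"
    by (simp add: inner_matrix_mult_left)
  ultimately show "1/2 * (norm ((U + h) ** transpose B - Z))\<^sup>2
      = 1/2 * (norm (U ** transpose B - Z))\<^sup>2 + inner ((U ** transpose B - Z) ** B) h
        + 1/2 * (norm (h ** transpose B))\<^sup>2"
    unfolding R_def[symmetric]
    by (simp add: power2_norm_eq_inner inner_simps inner_commute algebra_simps)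
next
  fix h :: "real^'k^'n"
  have "(norm (h ** transpose B))\<^sup>2 \<le> (norm h * norm B)\<^sup>2"
    using norm_matrix_mult_le[of h "transpose B"] by (intro power_mono) auto
  then show "\<bar>1/2 * (norm (h ** transpose B))\<^sup>2\<bar> \<le> 1/2 * (norm B)\<^sup>2 * (norm h)\<^sup>2"
    by (simp add: power_mult_distrib mult.commute)
qed (simp add: matrix_mult_scaleR_left power_mult_distrib)

text \<open>Transposing the residual keeps its norm and gives
  \<open>V ** transpose A - transpose Z\<close>, which is the case of a variable left
  factor.\<close>

lemma quad_expansion_residual_right:
  fixes Z :: "real^'m^'n" and A :: "real^'k^'n" and V :: "real^'k^'m"
  shows "quad_expansion (\<lambda>V. 1/2 * (norm (A ** transpose V - Z))\<^sup>2) V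
     (transpose (A ** transpose V - Z) ** A) (\<lambda>h. 1/2 * (norm (A ** transpose h))\<^sup>2)"
proof -
  have "transpose (A ** transpose W) = W ** transpose A" for W :: "real^'k^'m"
    by (simp add: matrix_transpose_mul)
  then have *: "norm (A ** transpose W) = norm (W ** transpose A)"
    "norm (A ** transpose W - Z) = norm (W ** transpose A - transpose Z)" for W :: "real^'k^'m"
    by (metis norm_transpose, metis norm_transpose transpose_diff)
  show ?thesis
    using quad_expansion_residual_left[of A "transpose Z" V]
    by (simp add: * transpose_diff matrix_transpose_mul)
qed

text \<open>\<open>grad\<close> is a definite description, so uniqueness is needed besides
  existence. Existence comes from the quadratic bound on \<open>q\<close>, uniqueness from that of
  the Frechet derivative.\<close>

lemma grad_quad_expansion:
  assumes "quad_expansion f x g q"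
  shows "grad f x = g"
proof -
  obtain c where c: "\<bar>q h\<bar> \<le> c * (norm h)\<^sup>2" for h
    using assms unfolding quad_expansion_def by blast
  have lim: "((\<lambda>h. c * norm h) \<longlongrightarrow> 0) (at (0::'a))"
    by (intro tendsto_mult_right_zero tendsto_norm_zero tendsto_ident_at)
  have "((\<lambda>h. norm (f (x + h) - f x - inner h g) / norm h) \<longlongrightarrow> 0) (at 0)"
  proof (rule tendsto_sandwich[OF _ _ tendsto_const lim])
    have "norm (f (x + h) - f x - inner h g) / norm h \<le> c * norm h" if "h \<noteq> 0" for h
    proof -
      have "f (x + h) - f x - inner h g = q h"
        using assms unfolding quad_expansion_def by (simp add: inner_commute)
      then show ?thesis
        using c[of h] that by (simp add: divide_le_eq power2_eq_square mult.assoc)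
    qed
    then show "\<forall>\<^sub>F h in at 0. norm (f (x + h) - f x - inner h g) / norm h \<le> c * norm h"
      by (simp add: eventually_at_filter)
  qed simp
  then have "GDERIV f x :> g"
    by (simp add: gderiv_def has_derivative_at bounded_linear_inner_left)
  moreover have "D = g" if "GDERIV f x :> D" for D
  proof -
    have "(\<lambda>h. inner h D) = (\<lambda>h. inner h g)"
      using that \<open>GDERIV f x :> g\<close> unfolding gderiv_def by (rule has_derivative_unique)
    then have "inner (D - g) D = inner (D - g) g"
      by metis
    then show ?thesis
      by (metis eq_iff_diff_eq_0 inner_diff_right inner_eq_zero_iff)
  qed
  ultimately show ?thesis
    unfolding grad_def by (rule the_equality)
qed

text \<open>A short step from \<open>y\<close> towards \<open>v\<close> stays in \<open>S\<close>; a
  negative slope would outweigh the term of order \<open>s\<^sup>2\<close>, whatever its sign, and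
  contradict minimality.\<close>

lemma quad_expansion_arg_min_on_convex:
  assumes qe: "quad_expansion f y g q" and "is_arg_min f (\<lambda>v. v \<in> S) y" and "convex S" "v \<in> S"
  shows "0 \<le> inner g (v - y)"
proof (rule ccontr)
  assume neg: "\<not> 0 \<le> inner g (v - y)"
  \<comment> \<open>With this \<open>s\<close>, the second-order term recovers at most half of the
    slope; the summand 1 keeps the denominator positive.\<close>
  define s where "s = min 1 (- inner g (v - y) / (1 + \<bar>q (v - y)\<bar>) / 2)"
  have s: "0 < s" "s \<le> 1"
    using neg by (auto simp: s_def divide_neg_pos)
  have "s \<le> - inner g (v - y) / (1 + \<bar>q (v - y)\<bar>) / 2"
    by (simp add: s_def)
  then have s2: "s * (1 + \<bar>q (v - y)\<bar>) \<le> - inner g (v - y) / 2"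
    by (simp add: field_simps)
  have "y \<in> S" and min: "\<And>w. w \<in> S \<Longrightarrow> f y \<le> f w"
    using assms(2) by (auto simp: is_arg_min_linorder)
  have "y + s *\<^sub>R (v - y) = (1 - s) *\<^sub>R y + s *\<^sub>R v"
    by (simp add: algebra_simps)
  also have "\<dots> \<in> S"
    using \<open>convex S\<close> \<open>y \<in> S\<close> \<open>v \<in> S\<close> s by (intro convexD) auto
  finally have "f y \<le> f (y + s *\<^sub>R (v - y))"
    by (rule min)
  also have "\<dots> = f y + s * (inner g (v - y) + s * q (v - y))"
    using qe unfolding quad_expansion_def by (simp add: power2_eq_square distrib_left mult.assoc)
  finally have "0 \<le> inner g (v - y) + s * q (v - y)"
    using s by (simp add: zero_le_mult_iff)
  moreover have "s * q (v - y) \<le> s * (1 + \<bar>q (v - y)\<bar>)"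
    using s by (intro mult_left_mono) auto
  ultimately show False
    using s2 neg by linarith
qed

lemma quad_expansion_arg_min_UNIV:
  assumes "quad_expansion f y g q" "is_arg_min f (\<lambda>v. True) y"
  shows "g = 0"
proof -
  have "0 \<le> inner g ((y - g) - y)"
    using assms by (intro quad_expansion_arg_min_on_convex[where S = UNIV]) auto
  then have "inner g g \<le> 0"
    by simp
  then show ?thesis
    by (metis inner_eq_zero_iff inner_ge_zero order_antisym)
qed


section \<open>The feasible set\<close>

text \<open>Turns the row constraint into a ball, whose convexity is known. \<open>sqrt\<close> is
  strictly increasing on all reals, so negative \<open>\<tau>\<close> is covered too.\<close>

lemma feasible_set_eq:
  "feasible_set \<tau> = {Y::real^'k^'n. (\<forall>i j. 0 \<le> Y $ i $ j) \<and> (\<forall>i. norm (Y $ i) \<le> sqrt \<tau>)}"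
proof -
  have "(norm y)\<^sup>2 \<le> \<tau> \<longleftrightarrow> norm y \<le> sqrt \<tau>" for y :: "real^'k"
    by (metis abs_norm_cancel real_sqrt_abs real_sqrt_le_iff)
  then show ?thesis
    by (simp add: feasible_set_def)
qed

lemma convex_feasible_set: "convex (feasible_set \<tau> :: (real^'k^'n) set)"
proof (rule convexI)
  fix U V :: "real^'k^'n" and u v :: real
  assume U: "U \<in> feasible_set \<tau>" and V: "V \<in> feasible_set \<tau>" and uv: "0 \<le> u" "0 \<le> v" "u + v = 1"
  have "norm ((u *\<^sub>R U + v *\<^sub>R V) $ i) \<le> sqrt \<tau>" for i
    using U V convexD[OF convex_cball _ _ uv, of "U $ i" 0 "sqrt \<tau>" "V $ i"]
    by (simp add: feasible_set_eq)
  then show "u *\<^sub>R U + v *\<^sub>R V \<in> feasible_set \<tau>"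
    using U V uv by (simp add: feasible_set_eq)
qed

lemma closed_feasible_set: "closed (feasible_set \<tau> :: (real^'k^'n) set)"
  unfolding feasible_set_def
  by (intro closed_Collect_conj closed_Collect_all closed_Collect_le continuous_intros)

lemma norm_feasible_set_le:
  fixes Y :: "real^'k^'n"
  assumes "Y \<in> feasible_set \<tau>"
  shows "(norm Y)\<^sup>2 \<le> real CARD('n) * \<tau>"
proof -
  have "(norm Y)\<^sup>2 \<le> (\<Sum>i\<in>(UNIV::'n set). \<tau>)"
    unfolding norm_matrix_power2 using assms by (intro sum_mono) (simp add: feasible_set_def)
  then show ?thesis
    by simp
qed

text \<open>\<open>ARG_MIN\<close> is a choice operator, so a minimiser has to exist first: the set
  is closed, and it contains 0 since \<open>0 \<le> \<tau>\<close>.\<close>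

lemma proj_feasible_closest:
  fixes W :: "real^'k^'n"
  assumes "0 \<le> \<tau>"
  shows "proj_feasible \<tau> W \<in> feasible_set \<tau>"
    and "V \<in> feasible_set \<tau> \<Longrightarrow> dist W (proj_feasible \<tau> W) \<le> dist W V"
proof -
  let ?S = "feasible_set \<tau> :: (real^'k^'n) set"
  have "0 \<in> ?S"
    using assms by (simp add: feasible_set_def)
  then obtain x where "x \<in> ?S" "\<forall>y\<in>?S. dist W x \<le> dist W y"
    using closest_point_exists[OF closed_feasible_set, of \<tau> W] by blast
  then have "is_arg_min (\<lambda>V. (norm (W - V))\<^sup>2) (\<lambda>V. V \<in> ?S) x"
    by (auto simp: is_arg_min_linorder dist_norm)
  then have "is_arg_min (\<lambda>V. (norm (W - V))\<^sup>2) (\<lambda>V. V \<in> ?S) (proj_feasible \<tau> W)"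
    unfolding proj_feasible_def arg_min_def by (rule someI)
  then show "proj_feasible \<tau> W \<in> ?S"
    and "V \<in> ?S \<Longrightarrow> dist W (proj_feasible \<tau> W) \<le> dist W V"
    by (auto simp: is_arg_min_linorder dist_norm)
qed

text \<open>The assumption on \<open>h\<close> says that \<open>Y\<close> is the projection of
  \<open>Y - h\<close>, so this is nonexpansiveness of the projection. It follows by adding the
  variational inequalities at \<open>p\<close> and at \<open>Y\<close>.\<close>

lemma dist_proj_feasible_le:
  fixes Y g h :: "real^'k^'n"
  assumes "0 \<le> \<tau>" and "Y \<in> feasible_set \<tau>"
    and h: "\<And>V. V \<in> feasible_set \<tau> \<Longrightarrow> 0 \<le> inner h (V - Y)"
  shows "norm (Y - proj_feasible \<tau> (Y - g)) \<le> norm (g - h)"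
proof -
  define p where "p = proj_feasible \<tau> (Y - g)"
  have p: "p \<in> feasible_set \<tau>"
    unfolding p_def by (rule proj_feasible_closest(1)[OF assms(1)])
  have "inner (Y - g - p) (Y - p) \<le> 0"
    using p assms proj_feasible_closest(2)[OF assms(1)]
    by (intro any_closest_point_dot[OF convex_feasible_set closed_feasible_set])
      (auto simp: p_def)
  moreover have "0 \<le> inner h (p - Y)"
    using h p by blast
  ultimately have "(norm (Y - p))\<^sup>2 \<le> inner (g - h) (Y - p)"
    by (simp add: power2_norm_eq_inner inner_simps inner_commute)
  also have "\<dots> \<le> norm (g - h) * norm (Y - p)"
    by (rule norm_cauchy_schwarz)
  finally show ?thesis
    unfolding p_def[symmetric] by (cases "Y = p") (auto simp: power2_eq_square)
qed


section \<open>The iteration\<close>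

lemma quad_expansion_aug_lagrangian_Y:
  "quad_expansion (\<lambda>V. aug_lagrangian Z \<rho> U V \<Lambda>) V
     (transpose (U ** transpose V - Z) ** U + \<Lambda> + \<rho> *\<^sub>R (V - U))
     (\<lambda>h. 1/2 * (norm (U ** transpose h))\<^sup>2 + \<rho>/2 * (norm h)\<^sup>2)"
  using quad_expansion_add[OF quad_expansion_add[OF quad_expansion_residual_right
        quad_expansion_inner_diff] quad_expansion_norm]
  unfolding aug_lagrangian_def by fastforce

lemma quad_expansion_aug_lagrangian_X:
  "quad_expansion (\<lambda>U. aug_lagrangian Z \<rho> U V \<Lambda>) U
     ((U ** transpose V - Z) ** V - \<Lambda> + \<rho> *\<^sub>R (U - V))
     (\<lambda>h. 1/2 * (norm (h ** transpose V))\<^sup>2 + \<rho>/2 * (norm h)\<^sup>2)"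
proof -
  have "inner (V - W) \<Lambda> = inner (W - V) (- \<Lambda>)" for W
    by (simp add: inner_simps)
  then have "aug_lagrangian Z \<rho> W V \<Lambda> =
      1/2 * (norm (W ** transpose V - Z))\<^sup>2 + inner (W - V) (- \<Lambda>) + \<rho>/2 * (norm (W - V))\<^sup>2" for W
    by (simp only: aug_lagrangian_def norm_minus_commute[of V])
  then show ?thesis
    using quad_expansion_add[OF quad_expansion_add[OF quad_expansion_residual_left[of V Z U]
          quad_expansion_inner_diff[of V "- \<Lambda>" U]] quad_expansion_norm[of \<rho> V U]]
    by simp
qed

lemma aug_lagrangian_multiplier:
  "aug_lagrangian Z \<rho> U V \<Lambda>' = aug_lagrangian Z \<rho> U V \<Lambda> + inner (V - U) (\<Lambda>' - \<Lambda>)"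
  by (simp add: aug_lagrangian_def inner_diff_right)

lemma power2_sum3_le:
  fixes x y z :: real
  shows "(x + y + z)\<^sup>2 \<le> 3 * (x\<^sup>2 + y\<^sup>2 + z\<^sup>2)"
proof -
  have "0 \<le> (x - y)\<^sup>2 + (y - z)\<^sup>2 + (x - z)\<^sup>2"
    by simp
  then show ?thesis
    by (simp add: power2_eq_square algebra_simps)
qed

lemma power2_sum2_le:
  fixes x y :: real
  shows "(x + y)\<^sup>2 \<le> 2 * (x\<^sup>2 + y\<^sup>2)"
  using sum_squares_bound[of x y] by (simp add: power2_eq_square algebra_simps)

locale ns_symnmf_run =
  fixes Z :: "real^'n^'n" and \<tau> \<rho> :: real
    and X Y \<Lambda> :: "nat \<Rightarrow> real^'k^'n" and \<beta> :: "nat \<Rightarrow> real"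
  assumes tau_pos: "0 < \<tau>" and rho_gt: "6 * real CARD('n) * \<tau> < \<rho>"
    and run: "ns_symnmf Z \<rho> \<tau> X Y \<Lambda> \<beta>"
begin

abbreviation residual :: "nat \<Rightarrow> real^'n^'n" where
  "residual t \<equiv> X t ** transpose (Y t) - Z"

abbreviation lagr :: "nat \<Rightarrow> real" where
  "lagr t \<equiv> aug_lagrangian Z \<rho> (X t) (Y t) (\<Lambda> t)"

abbreviation opt :: "nat \<Rightarrow> real" where
  "opt t \<equiv> opt_measure Z \<rho> \<tau> (X t) (Y t) (\<Lambda> t)"

abbreviation grad_Y :: "nat \<Rightarrow> real^'k^'n" where
  "grad_Y t \<equiv> transpose (residual t) ** X t + \<Lambda> t + \<rho> *\<^sub>R (Y t - X t)"

lemma n_tau_pos: "0 < real CARD('n) * \<tau>"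
  using tau_pos by simp

lemma rho_pos: "0 < \<rho>"
  using n_tau_pos rho_gt by simp

lemma Y_feasible: "Y (Suc t) \<in> feasible_set \<tau>"
  using run by (simp add: ns_symnmf_def is_arg_min_def)

lemma Lambda_Suc: "\<Lambda> (Suc t) = \<Lambda> t + \<rho> *\<^sub>R (Y (Suc t) - X (Suc t))"
  using run by (simp add: ns_symnmf_def)

lemma beta_Suc: "\<beta> (Suc t) = 6 / \<rho> * (norm (residual (Suc t)))\<^sup>2"
  using run by (simp add: ns_symnmf_def)

section \<open>First-order optimality of the primal steps\<close>

text \<open>The first three summands are the \<open>Y\<close>-gradient of the augmented Lagrangian
  at the old \<open>X\<close> and \<open>\<Lambda>\<close>; the last one stems from the proximal
  term.\<close>

lemma Y_step_optimality:
  assumes "V \<in> feasible_set \<tau>"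
  shows "0 \<le> inner (transpose (X t ** transpose (Y (Suc t)) - Z) ** X t + \<Lambda> t
           + \<rho> *\<^sub>R (Y (Suc t) - X t) + \<beta> t *\<^sub>R (Y (Suc t) - Y t)) (V - Y (Suc t))"
proof -
  let ?f = "\<lambda>V. 1/2 * (norm (X t ** transpose V - Z))\<^sup>2
      + \<rho>/2 * (norm (V - (X t - \<Lambda> t /\<^sub>R \<rho>)))\<^sup>2 + \<beta> t / 2 * (norm (V - Y t))\<^sup>2"
  let ?g = "transpose (X t ** transpose (Y (Suc t)) - Z) ** X t
      + \<rho> *\<^sub>R (Y (Suc t) - (X t - \<Lambda> t /\<^sub>R \<rho>)) + \<beta> t *\<^sub>R (Y (Suc t) - Y t)"
  have "is_arg_min ?f (\<lambda>V. V \<in> feasible_set \<tau>) (Y (Suc t))"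
    using run by (simp add: ns_symnmf_def algebra_simps)
  with quad_expansion_add[OF quad_expansion_add[OF quad_expansion_residual_right
        quad_expansion_norm] quad_expansion_norm]
  have "0 \<le> inner ?g (V - Y (Suc t))"
    using convex_feasible_set assms by (rule quad_expansion_arg_min_on_convex)
  then show ?thesis
    using rho_pos by (simp add: algebra_simps)
qed

text \<open>Stationarity gives \<open>\<Lambda> t + \<rho> *\<^sub>R (Y (Suc t) - X (Suc t))\<close>
  for the left side, which is precisely the multiplier update.\<close>

lemma X_step_optimality: "residual (Suc t) ** Y (Suc t) = \<Lambda> (Suc t)"
proof -
  let ?f = "\<lambda>U. 1/2 * (norm (U ** transpose (Y (Suc t)) - Z))\<^sup>2
      + \<rho>/2 * (norm (U - (\<Lambda> t /\<^sub>R \<rho> + Y (Suc t))))\<^sup>2"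
  have "is_arg_min ?f (\<lambda>V. True) (X (Suc t))"
    using run by (simp add: ns_symnmf_def diff_diff_eq)
  with quad_expansion_add[OF quad_expansion_residual_left quad_expansion_norm]
  have "residual (Suc t) ** Y (Suc t) + \<rho> *\<^sub>R (X (Suc t) - (\<Lambda> t /\<^sub>R \<rho> + Y (Suc t))) = 0"
    by (rule quad_expansion_arg_min_UNIV)
  then have "residual (Suc t) ** Y (Suc t) = - (\<rho> *\<^sub>R (X (Suc t) - (\<Lambda> t /\<^sub>R \<rho> + Y (Suc t))))"
    by (simp only: eq_neg_iff_add_eq_0)
  also have "\<dots> = \<Lambda> (Suc t)"
    using rho_pos by (simp add: Lambda_Suc algebra_simps)
  finally show ?thesis .
qed

section \<open>Sufficient decrease of the augmented Lagrangian\<close>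

text \<open>The factors of \<open>\<Lambda> = R Y\<close> are exchanged one at a time. The order is
  chosen so that the first two terms contain the curvature terms of the \<open>X\<close>- and
  \<open>Y\<close>-steps, and the third is matched by the proximal weight.\<close>

lemma Lambda_diff:
  assumes "1 \<le> t"
  shows "\<Lambda> t - \<Lambda> (Suc t) = (X t - X (Suc t)) ** transpose (Y (Suc t)) ** Y (Suc t)
     + X t ** transpose (Y t - Y (Suc t)) ** Y (Suc t) + residual t ** (Y t - Y (Suc t))"
proof -
  have "residual t ** Y t = \<Lambda> t"
    using assms X_step_optimality[of "t - 1"] by simp
  then show ?thesis
    unfolding X_step_optimality[of t, symmetric]
    by (simp add: matrix_mult_diff_left matrix_mult_diff_right transpose_diff)
qed

lemma lagr_Suc_le:
  assumes "1 \<le> t"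
  shows "lagr (Suc t) \<le> lagr t - \<rho>/2 * ((norm (X t - X (Suc t)))\<^sup>2 + (norm (Y t - Y (Suc t)))\<^sup>2)"
proof -
  define dX where "dX = X t - X (Suc t)"
  define dY where "dY = Y t - Y (Suc t)"
  define u where "u = (norm (dX ** transpose (Y (Suc t))))\<^sup>2"
  define v where "v = (norm (X t ** transpose dY))\<^sup>2"
  define dL where "dL = \<Lambda> t - \<Lambda> (Suc t)"
  let ?Y' = "Y (Suc t)" and ?X' = "X (Suc t)"
  \<comment> \<open>Needs \<open>1 \<le> t\<close>; the old iterate serves below as test point in
    the variational inequality of the \<open>Y\<close>-step.\<close>
  have Y_t: "Y t \<in> feasible_set \<tau>"
    using Y_feasible[of "t - 1"] assms by simp
  have beta: "\<rho> * \<beta> t = 6 * (norm (residual t))\<^sup>2"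
    using beta_Suc[of "t - 1"] assms rho_pos by simp
  then have "0 \<le> \<rho> * \<beta> t"
    by simp
  then have beta_nonneg: "0 \<le> \<beta> t"
    using rho_pos by (simp add: zero_le_mult_iff)

  have "(norm dL)\<^sup>2 \<le> (norm (dX ** transpose ?Y' ** ?Y') + norm (X t ** transpose dY ** ?Y')
      + norm (residual t ** dY))\<^sup>2"
    unfolding dL_def Lambda_diff[OF assms] dX_def dY_def
    by (intro power_mono norm_triangle_mono norm_triangle_ineq order_refl norm_ge_zero)
  also have "\<dots> \<le> 3 * ((norm (dX ** transpose ?Y' ** ?Y'))\<^sup>2 + (norm (X t ** transpose dY ** ?Y'))\<^sup>2
      + (norm (residual t ** dY))\<^sup>2)"
    by (rule power2_sum3_le)
  also have "\<dots> \<le> 3 * (u * (norm ?Y')\<^sup>2 + v * (norm ?Y')\<^sup>2 + (norm (residual t))\<^sup>2 * (norm dY)\<^sup>2)"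
    unfolding u_def v_def power_mult_distrib[symmetric]
    by (intro mult_left_mono add_mono power_mono norm_matrix_mult_le) auto
  also have "\<dots> = (u + v) * (3 * (norm ?Y')\<^sup>2) + 3 * (norm (residual t))\<^sup>2 * (norm dY)\<^sup>2"
    by (simp add: algebra_simps)
  \<comment> \<open>Here \<open>\<rho> > 6 N \<tau>\<close> enters, as
    \<open>3 * (norm ?Y')\<^sup>2 \<le> 3 N \<tau> < \<rho> / 2\<close>. The 6 in
    \<open>\<beta>\<close> likewise turns \<open>3 * (norm (residual t))\<^sup>2\<close> into
    \<open>\<rho> * \<beta> t / 2\<close>.\<close>
  also have "\<dots> \<le> (u + v) * (\<rho> / 2) + 3 * (norm (residual t))\<^sup>2 * (norm dY)\<^sup>2"
    using norm_feasible_set_le[OF Y_feasible[of t]] rho_gt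
    by (intro add_right_mono mult_left_mono) (auto simp: u_def v_def)
  also have "\<dots> = (u + v) * (\<rho> / 2) + (\<rho> * \<beta> t) / 2 * (norm dY)\<^sup>2"
    unfolding beta by simp
  also have "\<dots> = \<rho> * (u/2 + v/2 + \<beta> t / 2 * (norm dY)\<^sup>2)"
    by (simp add: algebra_simps)
  finally have dL: "(norm dL)\<^sup>2 \<le> \<rho> * (u/2 + v/2 + \<beta> t / 2 * (norm dY)\<^sup>2)" .

  \<comment> \<open>Decrease in the \<open>Y\<close>-step: expansion about the new point, with
    linear term bounded below by optimality against \<open>Y t\<close>.\<close>
  have "lagr t = aug_lagrangian Z \<rho> (X t) ?Y' (\<Lambda> t)
      + inner (transpose (X t ** transpose ?Y' - Z) ** X t + \<Lambda> t + \<rho> *\<^sub>R (?Y' - X t)) dY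
      + (1/2 * v + \<rho>/2 * (norm dY)\<^sup>2)"
    unfolding v_def dY_def by (rule quad_expansionD[OF quad_expansion_aug_lagrangian_Y])
  moreover have "\<beta> t * (norm dY)\<^sup>2 \<le>
      inner (transpose (X t ** transpose ?Y' - Z) ** X t + \<Lambda> t + \<rho> *\<^sub>R (?Y' - X t)) dY"
  proof -
    have "?Y' - Y t = - dY"
      by (simp add: dY_def)
    then show ?thesis
      using Y_step_optimality[OF Y_t, of t]
      by (simp add: inner_add_left inner_diff_left power2_norm_eq_inner flip: dY_def)
  qed
  ultimately have Y_descent: "aug_lagrangian Z \<rho> (X t) ?Y' (\<Lambda> t)
      \<le> lagr t - \<beta> t * (norm dY)\<^sup>2 - v/2 - \<rho>/2 * (norm dY)\<^sup>2"
    by linarith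

  \<comment> \<open>The \<open>X\<close>-gradient with the old multiplier vanishes at the new
    \<open>X\<close>, so only the quadratic part remains as decrease.\<close>
  have "residual (Suc t) ** ?Y' - \<Lambda> t + \<rho> *\<^sub>R (?X' - ?Y') = 0"
    unfolding X_step_optimality by (simp add: Lambda_Suc algebra_simps)
  with quad_expansionD[OF quad_expansion_aug_lagrangian_X, of Z \<rho> "X t" ?Y' "\<Lambda> t" ?X']
  have X_descent: "aug_lagrangian Z \<rho> (X t) ?Y' (\<Lambda> t)
      = aug_lagrangian Z \<rho> ?X' ?Y' (\<Lambda> t) + (1/2 * u + \<rho>/2 * (norm dX)\<^sup>2)"
    by (simp add: u_def dX_def)

  \<comment> \<open>The multiplier step raises the Lagrangian by exactly
    \<open>(norm dL)\<^sup>2 / \<rho>\<close>, which the curvature terms and half of the proximal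
    gain pay for.\<close>
  have "\<Lambda> (Suc t) - \<Lambda> t = - dL" "?Y' - ?X' = - (dL /\<^sub>R \<rho>)"
    using rho_pos by (simp_all add: dL_def Lambda_Suc)
  then have "inner (?Y' - ?X') (\<Lambda> (Suc t) - \<Lambda> t) = (norm dL)\<^sup>2 / \<rho>"
    by (simp add: power2_norm_eq_inner divide_inverse mult.commute)
  also have "\<dots> \<le> u/2 + v/2 + \<beta> t / 2 * (norm dY)\<^sup>2"
    using dL rho_pos by (simp add: divide_le_eq mult.commute)
  finally have "lagr (Suc t) \<le> aug_lagrangian Z \<rho> ?X' ?Y' (\<Lambda> t) + u/2 + v/2 + \<beta> t / 2 * (norm dY)\<^sup>2"
    using aug_lagrangian_multiplier[of Z \<rho> ?X' ?Y' "\<Lambda> (Suc t)" "\<Lambda> t"] by linarith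
  moreover have "0 \<le> \<beta> t * (norm dY)\<^sup>2"
    using beta_nonneg by simp
  ultimately show ?thesis
    using X_descent Y_descent unfolding dX_def[symmetric] dY_def[symmetric]
    by (simp add: algebra_simps)
qed

section \<open>Lower bound and boundedness of the iterates\<close>

text \<open>Only the multiplier term can be negative. By \<open>\<Lambda> = R Y\<close> and Young's
  inequality it costs at most a quarter of the squared residual and \<open>N \<tau>\<close> times
  the squared gap, while \<open>\<rho>/2\<close> exceeds \<open>3 N \<tau>\<close>.\<close>

lemma lagr_ge:
  assumes "1 \<le> t"
  shows "1/4 * (norm (residual t))\<^sup>2 + 2 * (real CARD('n) * \<tau>) * (norm (X t - Y t))\<^sup>2 \<le> lagr t"
proof -
  define a where "a = norm (residual t)"
  define d where "d = norm (Y t - X t)"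
  define y where "y = norm (Y t)"
  have y: "y\<^sup>2 \<le> real CARD('n) * \<tau>"
    using norm_feasible_set_le[OF Y_feasible[of "t - 1"]] assms by (simp add: y_def)
  have "norm (\<Lambda> t) \<le> a * y"
    using X_step_optimality[of "t - 1"] assms norm_matrix_mult_le[of "residual t" "Y t"]
    by (simp add: a_def y_def)
  then have "norm (Y t - X t) * norm (\<Lambda> t) \<le> d * (a * y)"
    unfolding d_def by (intro mult_left_mono) auto
  then have "- (d * (a * y)) \<le> inner (Y t - X t) (\<Lambda> t)"
    using Cauchy_Schwarz_ineq2[of "Y t - X t" "\<Lambda> t"] by linarith
  moreover have "0 \<le> (a/2 - d * y)\<^sup>2"
    by simp
  then have "d * (a * y) \<le> 1/4 * a\<^sup>2 + y\<^sup>2 * d\<^sup>2"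
    by (simp add: power2_eq_square algebra_simps)
  moreover have "y\<^sup>2 * d\<^sup>2 \<le> (real CARD('n) * \<tau>) * d\<^sup>2"
    using y by (intro mult_right_mono) auto
  moreover have "3 * (real CARD('n) * \<tau>) * d\<^sup>2 \<le> \<rho>/2 * d\<^sup>2"
    using rho_gt by (intro mult_right_mono) auto
  ultimately show ?thesis
    unfolding aug_lagrangian_def norm_minus_commute[of "X t"] a_def[symmetric] d_def[symmetric]
    by linarith
qed

lemma lagr_nonneg:
  assumes "1 \<le> t"
  shows "0 \<le> lagr t"
proof -
  have "0 \<le> 1/4 * (norm (residual t))\<^sup>2 + 2 * (real CARD('n) * \<tau>) * (norm (X t - Y t))\<^sup>2"
    using tau_pos by simp
  then show ?thesis
    using lagr_ge[OF assms] by linarith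
qed

lemma residual_le_lagr:
  assumes "1 \<le> t"
  shows "(norm (residual t))\<^sup>2 \<le> 4 * lagr t"
proof -
  have "0 \<le> 2 * (real CARD('n) * \<tau>) * (norm (X t - Y t))\<^sup>2"
    using tau_pos by simp
  then show ?thesis
    using lagr_ge[OF assms] by linarith
qed

lemma primal_gap_le_lagr:
  assumes "1 \<le> t"
  shows "(norm (X t - Y t))\<^sup>2 \<le> lagr t / (2 * (real CARD('n) * \<tau>))"
proof -
  have "2 * (real CARD('n) * \<tau>) * (norm (X t - Y t))\<^sup>2 \<le> lagr t"
    using lagr_ge[OF assms] zero_le_power2[of "norm (residual t)"] by linarith
  then show ?thesis
    using tau_pos by (simp add: pos_le_divide_eq mult.commute)
qed

lemma lagr_le_lagr_1:
  assumes "1 \<le> t"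
  shows "lagr t \<le> lagr 1"
  using assms
proof (induction t rule: dec_induct)
  case (step t)
  have "0 \<le> \<rho>/2 * ((norm (X t - X (Suc t)))\<^sup>2 + (norm (Y t - Y (Suc t)))\<^sup>2)"
    using rho_pos by simp
  then show ?case
    using lagr_Suc_le[of t] step by linarith
qed simp

lemma bounded_iterates:
  obtains M where "0 \<le> M"
    and "\<And>t. 1 \<le> t \<Longrightarrow> norm (X t) \<le> M" and "\<And>t. 1 \<le> t \<Longrightarrow> norm (Y t) \<le> M"
    and "\<And>t. 1 \<le> t \<Longrightarrow> norm (residual t) \<le> M" and "\<And>t. 1 \<le> t \<Longrightarrow> \<bar>\<beta> t\<bar> \<le> M"
proof
  define N where "N = real CARD('n) * \<tau>"
  have N: "0 < N"
    using tau_pos by (simp add: N_def)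
  let ?B = "lagr 1"
  \<comment> \<open>A sum of nonnegative bounds: for the residual, for \<open>X\<close> (gap plus
    \<open>norm (Y t)\<close>), and for \<open>\<beta>\<close>, where
    \<open>6 / \<rho> * (4 * ?B)\<close> gives the 24.\<close>
  let ?M = "sqrt (4 * ?B) + (sqrt (?B / (2 * N)) + sqrt N) + 24 * ?B / \<rho>"
  have B: "0 \<le> ?B"
    by (rule lagr_nonneg) simp
  then have nonneg: "0 \<le> sqrt (4 * ?B)" "0 \<le> sqrt (?B / (2 * N))" "0 \<le> sqrt N" "0 \<le> 24 * ?B / \<rho>"
    using N rho_pos by auto
  then show "0 \<le> ?M"
    by linarith
  fix t :: nat
  assume t: "1 \<le> t"
  have R2: "(norm (residual t))\<^sup>2 \<le> 4 * ?B"
    using residual_le_lagr[OF t] lagr_le_lagr_1[OF t] by linarith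
  then have "norm (residual t) \<le> sqrt (4 * ?B)"
    by (rule real_le_rsqrt)
  then show "norm (residual t) \<le> ?M"
    using nonneg by linarith
  have Y: "norm (Y t) \<le> sqrt N"
    using norm_feasible_set_le[OF Y_feasible[of "t - 1"]] t by (simp add: real_le_rsqrt N_def)
  then show "norm (Y t) \<le> ?M"
    using nonneg by linarith
  have "(norm (X t - Y t))\<^sup>2 \<le> lagr t / (2 * N)"
    using primal_gap_le_lagr[OF t] by (simp add: N_def)
  also have "\<dots> \<le> ?B / (2 * N)"
    using lagr_le_lagr_1[OF t] N by (intro divide_right_mono) auto
  finally have "norm (X t - Y t) \<le> sqrt (?B / (2 * N))"
    by (rule real_le_rsqrt)
  then show "norm (X t) \<le> ?M"
    using Y nonneg norm_triangle_ineq2[of "X t" "Y t"] by linarith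
  have "\<bar>\<beta> t\<bar> = 6 / \<rho> * (norm (residual t))\<^sup>2"
    using beta_Suc[of "t - 1"] t rho_pos by simp
  also have "\<dots> \<le> 6 / \<rho> * (4 * ?B)"
    using R2 rho_pos by (intro mult_left_mono) auto
  finally have "\<bar>\<beta> t\<bar> \<le> 24 * ?B / \<rho>"
    by simp
  then show "\<bar>\<beta> t\<bar> \<le> ?M"
    using nonneg by linarith
qed

section \<open>Bounds on the optimality measure\<close>

text \<open>
  The vector \<open>h\<close> is the gradient of the \<open>Y\<close>-subproblem that produced \<open>Y t\<close>, or \<open>0\<close>.
\<close>

lemma opt_le:
  assumes "1 \<le> t" and "\<And>V. V \<in> feasible_set \<tau> \<Longrightarrow> 0 \<le> inner h (V - Y t)"
    and "norm (grad_Y t - h) \<le> e"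
  shows "opt t \<le> e\<^sup>2 + (\<rho>\<^sup>2 + 1) * (norm (X t - Y t))\<^sup>2"
proof -
  have "grad (\<lambda>V. aug_lagrangian Z \<rho> (X t) V (\<Lambda> t)) (Y t) = grad_Y t"
    by (rule grad_quad_expansion[OF quad_expansion_aug_lagrangian_Y])
  \<comment> \<open>By \<open>\<Lambda> = R Y\<close> only the penalty part survives; its square and
    the gap itself give the factor \<open>\<rho>\<^sup>2 + 1\<close>.\<close>
  moreover have "grad (\<lambda>U. aug_lagrangian Z \<rho> U (Y t) (\<Lambda> t)) (X t) = \<rho> *\<^sub>R (X t - Y t)"
    using grad_quad_expansion[OF quad_expansion_aug_lagrangian_X, of Z \<rho> "Y t" "\<Lambda> t" "X t"]
      X_step_optimality[of "t - 1"] assms(1) by simp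
  moreover have "norm (Y t - proj_feasible \<tau> (Y t - grad_Y t)) \<le> e"
    using dist_proj_feasible_le[of \<tau> "Y t" h "grad_Y t"] assms tau_pos Y_feasible[of "t - 1"] by simp
  then have "(norm (Y t - proj_feasible \<tau> (Y t - grad_Y t)))\<^sup>2 \<le> e\<^sup>2"
    by (intro power_mono) auto
  ultimately show ?thesis
    by (simp add: opt_measure_def power_mult_distrib distrib_right)
qed

text \<open>No descent estimate covers the step into iterate 1. Instead the whole gradient is
  bounded by residual and gap, both controlled by \<open>lagr 1\<close>.\<close>

lemma opt_1_le: "\<exists>C\<ge>0. opt 1 \<le> C * lagr 1"
proof -
  obtain M where M: "0 \<le> M" "norm (X 1) \<le> M" "norm (Y 1) \<le> M"
    using bounded_iterates by (metis order_refl)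
  define r where "r = norm (residual 1)"
  define d where "d = norm (X 1 - Y 1)"
  have \<Lambda>: "\<Lambda> 1 = residual 1 ** Y 1"
    using X_step_optimality[of 0] by simp
  have "norm (transpose (residual 1) ** X 1) \<le> r * M"
    using norm_matrix_mult_le[of "transpose (residual 1)" "X 1"] M(2)
      mult_left_mono[of "norm (X 1)" M r] by (simp add: r_def)
  moreover have "norm (\<Lambda> 1) \<le> r * M"
    unfolding \<Lambda> using norm_matrix_mult_le[of "residual 1" "Y 1"] M(3)
      mult_left_mono[of "norm (Y 1)" M r] by (simp add: r_def)
  moreover have "norm (\<rho> *\<^sub>R (Y 1 - X 1)) = \<rho> * d"
    using rho_pos by (simp add: d_def norm_minus_commute)
  ultimately have "norm (grad_Y 1) \<le> r * M + r * M + \<rho> * d"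
    by (metis norm_triangle_le norm_triangle_mono order_refl)
  \<comment> \<open>\<open>h = 0\<close> satisfies the variational inequality trivially.\<close>
  then have "opt 1 \<le> (r * M + r * M + \<rho> * d)\<^sup>2 + (\<rho>\<^sup>2 + 1) * (norm (X 1 - Y 1))\<^sup>2"
    using opt_le[of 1 0] by simp
  also have "\<dots> \<le> 3 * ((r * M)\<^sup>2 + (r * M)\<^sup>2 + (\<rho> * d)\<^sup>2) + (\<rho>\<^sup>2 + 1) * d\<^sup>2"
    unfolding d_def[symmetric] by (intro add_right_mono power2_sum3_le)
  also have "\<dots> = 6 * M\<^sup>2 * r\<^sup>2 + (4 * \<rho>\<^sup>2 + 1) * d\<^sup>2"
    by (simp add: power_mult_distrib algebra_simps)
  also have "\<dots> \<le> 6 * M\<^sup>2 * (4 * lagr 1) + (4 * \<rho>\<^sup>2 + 1) * (lagr 1 / (2 * (real CARD('n) * \<tau>)))"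
    unfolding r_def d_def
    by (intro add_mono mult_left_mono residual_le_lagr primal_gap_le_lagr) auto
  also have "\<dots> = (24 * M\<^sup>2 + (4 * \<rho>\<^sup>2 + 1) / (2 * (real CARD('n) * \<tau>))) * lagr 1"
    by (simp add: algebra_simps)
  finally show ?thesis
    using tau_pos by (intro exI[of _ "24 * M\<^sup>2 + (4 * \<rho>\<^sup>2 + 1) / (2 * (real CARD('n) * \<tau>))"]) simp
qed

text \<open>With \<open>h\<close> the gradient of the \<open>Y\<close>-subproblem,
  \<open>grad_Y (Suc t) - h\<close> contains only changes of \<open>X\<close>, \<open>Y\<close> and
  \<open>\<Lambda>\<close>, with bounded coefficients.\<close>

lemma opt_Suc_le:
  "\<exists>C\<ge>0. \<forall>t\<ge>1. opt (Suc t) \<le> C * ((norm (X t - X (Suc t)))\<^sup>2 + (norm (Y t - Y (Suc t)))\<^sup>2)"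
proof -
  obtain M where M: "0 \<le> M"
    "\<And>t. 1 \<le> t \<Longrightarrow> norm (X t) \<le> M" "\<And>t. 1 \<le> t \<Longrightarrow> norm (Y t) \<le> M"
    "\<And>t. 1 \<le> t \<Longrightarrow> norm (residual t) \<le> M" "\<And>t. 1 \<le> t \<Longrightarrow> \<bar>\<beta> t\<bar> \<le> M"
    by (fact bounded_iterates)
  define K where "K = M * M + M"
  have K: "0 \<le> K"
    using M(1) by (simp add: K_def)
  \<comment> \<open>\<open>2 * K + \<rho>\<close> bounds the gradient deviation and
    \<open>K / \<rho>\<close> the primal gap, relative to \<open>d\<close>; the outer 2 comes from
    squaring the sum \<open>d\<close>.\<close>
  define C where "C = 2 * ((2 * K + \<rho>)\<^sup>2 + (\<rho>\<^sup>2 + 1) * (K / \<rho>)\<^sup>2)"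
  have "opt (Suc t) \<le> C * ((norm (X t - X (Suc t)))\<^sup>2 + (norm (Y t - Y (Suc t)))\<^sup>2)"
    if t: "1 \<le> t" for t
  proof -
    let ?Y' = "Y (Suc t)" and ?X' = "X (Suc t)"
    define dX where "dX = X t - ?X'"
    define dY where "dY = Y t - ?Y'"
    define dL where "dL = \<Lambda> t - \<Lambda> (Suc t)"
    define d where "d = norm dX + norm dY"
    have mult: "norm (A ** B) \<le> a * b" if "norm A \<le> a" "norm B \<le> b"
      for A :: "real^'p^'q" and B :: "real^'s^'p" and a b
      using norm_matrix_mult_le[of A B] mult_mono'[OF that] by simp
    have bounds: "norm (X t) \<le> M" "norm ?Y' \<le> M" "norm (residual t) \<le> M"
      "norm (residual (Suc t)) \<le> M" "\<bar>\<beta> t\<bar> \<le> M"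
      using M t by auto

    have "norm (dX ** transpose ?Y' ** ?Y') \<le> norm dX * M * M"
      by (intro mult) (auto simp: bounds)
    moreover have "norm (X t ** transpose dY ** ?Y') \<le> M * norm dY * M"
      by (intro mult) (auto simp: bounds)
    moreover have "norm (residual t ** dY) \<le> M * norm dY"
      by (intro mult) (auto simp: bounds)
    ultimately have "norm dL \<le> norm dX * M * M + M * norm dY * M + M * norm dY"
      unfolding dL_def Lambda_diff[OF t] dX_def[symmetric] dY_def[symmetric]
      by (metis norm_triangle_mono)
    moreover have "0 \<le> M * norm dX"
      using M(1) by simp
    ultimately have dL: "norm dL \<le> K * d"
      by (simp add: K_def d_def algebra_simps)

    let ?h = "transpose (X t ** transpose ?Y' - Z) ** X t + \<Lambda> t
           + \<rho> *\<^sub>R (?Y' - X t) + \<beta> t *\<^sub>R (?Y' - Y t)"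
    \<comment> \<open>Uses \<open>X t ** transpose ?Y' - Z = residual (Suc t) + dX ** transpose
      ?Y'\<close>.\<close>
    have "grad_Y (Suc t) - ?h = (\<rho> *\<^sub>R dX + \<beta> t *\<^sub>R dY) - transpose (residual (Suc t)) ** dX
        - transpose (dX ** transpose ?Y') ** X t - dL"
      by (simp add: dX_def dY_def dL_def matrix_mult_diff_left matrix_mult_diff_right
          transpose_diff algebra_simps)
    moreover have "norm (transpose (residual (Suc t)) ** dX) \<le> M * norm dX"
      by (intro mult) (auto simp: bounds)
    moreover have "norm (transpose (dX ** transpose ?Y') ** X t) \<le> norm dX * M * M"
    proof (intro mult)
      show "norm (transpose (dX ** transpose ?Y')) \<le> norm dX * M"
        unfolding norm_transpose by (intro mult) (auto simp: bounds)
    qed (auto simp: bounds)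
    moreover have "norm (\<rho> *\<^sub>R dX + \<beta> t *\<^sub>R dY) \<le> \<rho> * norm dX + M * norm dY"
      using rho_pos bounds(5) by (intro norm_triangle_mono) (auto intro: mult_right_mono)
    ultimately have "norm (grad_Y (Suc t) - ?h)
        \<le> (\<rho> * norm dX + M * norm dY) + M * norm dX + norm dX * M * M + K * d"
      using dL by (smt (verit) norm_triangle_ineq4)
    also have "\<dots> \<le> (2 * K + \<rho>) * d"
    proof -
      have "0 \<le> M * M * norm dY" "0 \<le> \<rho> * norm dY"
        using rho_pos by simp_all
      then show ?thesis
        by (simp add: K_def d_def algebra_simps)
    qed
    finally have "opt (Suc t) \<le> ((2 * K + \<rho>) * d)\<^sup>2 + (\<rho>\<^sup>2 + 1) * (norm (?X' - ?Y'))\<^sup>2"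
      by (intro opt_le[where h = ?h] Y_step_optimality) auto
    \<comment> \<open>The multiplier update turns the primal gap into a multiplier change.\<close>
    also have "norm (?X' - ?Y') = norm dL / \<rho>"
      using rho_pos by (simp add: dL_def Lambda_Suc norm_minus_commute)
    also have "(norm dL / \<rho>)\<^sup>2 \<le> (K / \<rho> * d)\<^sup>2"
      using dL rho_pos by (intro power_mono) (auto simp: divide_right_mono)
    finally have "opt (Suc t) \<le> ((2 * K + \<rho>) * d)\<^sup>2 + (\<rho>\<^sup>2 + 1) * (K / \<rho> * d)\<^sup>2"
      by (simp add: mult_left_mono)
    also have "\<dots> = C / 2 * d\<^sup>2"
      unfolding C_def power_mult_distrib by (simp add: distrib_right)
    also have "\<dots> \<le> C / 2 * (2 * ((norm dX)\<^sup>2 + (norm dY)\<^sup>2))"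
      unfolding d_def by (intro mult_left_mono power2_sum2_le) (simp add: C_def)
    also have "\<dots> = C * ((norm dX)\<^sup>2 + (norm dY)\<^sup>2)"
      by simp
    finally show ?thesis
      by (simp only: dX_def dY_def)
  qed
  moreover have "0 \<le> C"
    by (simp add: C_def)
  ultimately show ?thesis
    by blast
qed

section \<open>Summation and the iteration count\<close>

lemma sum_opt_le: "\<exists>C\<ge>0. \<forall>n. (\<Sum>t=1..n. opt t) \<le> C * lagr 1"
proof -
  obtain C1 where C1: "0 \<le> C1" "opt 1 \<le> C1 * lagr 1"
    using opt_1_le by blast
  obtain C2 where C2: "0 \<le> C2" and step: "\<And>t. 1 \<le> t \<Longrightarrow>
      opt (Suc t) \<le> C2 * ((norm (X t - X (Suc t)))\<^sup>2 + (norm (Y t - Y (Suc t)))\<^sup>2)"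
    using opt_Suc_le by blast
  have step': "opt (Suc t) \<le> C2 * (2 / \<rho>) * (lagr t - lagr (Suc t))" if "1 \<le> t" for t
  proof -
    have "(norm (X t - X (Suc t)))\<^sup>2 + (norm (Y t - Y (Suc t)))\<^sup>2 \<le> 2 / \<rho> * (lagr t - lagr (Suc t))"
      using lagr_Suc_le[OF that] rho_pos by (simp add: field_simps)
    then show ?thesis
      using step[OF that] C2 by (smt (verit) mult.assoc mult_left_mono)
  qed
  have tele: "(\<Sum>t=1..Suc n. opt t) \<le> C1 * lagr 1 + C2 * (2 / \<rho>) * (lagr 1 - lagr (Suc n))" for n
  proof (induction n)
    case 0
    then show ?case
      using C1 by simp
  next
    case (Suc n)
    then show ?case
      using step'[of "Suc n"] by (simp add: algebra_simps)
  qed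
  have "(\<Sum>t=1..n. opt t) \<le> (C1 + C2 * (2 / \<rho>)) * lagr 1" for n
  proof (cases n)
    case 0
    then show ?thesis
      using C1(1) C2 rho_pos lagr_nonneg[of 1] by simp
  next
    case (Suc m)
    have "0 \<le> C2 * (2 / \<rho>) * lagr (Suc m)"
      using C2 rho_pos lagr_nonneg[of "Suc m"] by simp
    then show ?thesis
      using tele[of m] unfolding Suc by (simp add: algebra_simps)
  qed
  then show ?thesis
    using C1(1) C2 rho_pos by (intro exI[of _ "C1 + C2 * (2 / \<rho>)"]) simp
qed

end

text \<open>The existence clause makes the \<open>LEAST\<close> a genuine minimum. Excluded are
  index 0, where the quotient is undefined, and index 1 with vanishing Lagrangian, where the bound
  would read \<open>\<epsilon> \<le> 0\<close>. \<open>C\<close> may depend on the run but not on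
  \<open>\<epsilon>\<close>.\<close>

theorem theorem2:
  fixes Z :: "real^'n^'n" and \<tau> \<rho> :: real
    and X Y \<Lambda> :: "nat \<Rightarrow> real^'k^'n" and \<beta> :: "nat \<Rightarrow> real"
  assumes "CARD('k) \<le> CARD('n)"
    and "\<tau> > 0"
    and "\<rho> > 6 * real CARD('n) * \<tau>"
    and "ns_symnmf Z \<rho> \<tau> X Y \<Lambda> \<beta>"
  shows "\<exists>C>0. \<forall>\<epsilon>>0.
    (\<exists>t. opt_measure Z \<rho> \<tau> (X t) (Y t) (\<Lambda> t) \<le> \<epsilon>) \<and>
    (iter_index Z \<rho> \<tau> X Y \<Lambda> \<epsilon> \<noteq> 0 \<and>
     (iter_index Z \<rho> \<tau> X Y \<Lambda> \<epsilon> = 1 \<longrightarrow> aug_lagrangian Z \<rho> (X 1) (Y 1) (\<Lambda> 1) \<noteq> 0) \<longrightarrow>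
     \<epsilon> \<le> C * aug_lagrangian Z \<rho> (X 1) (Y 1) (\<Lambda> 1) / real (iter_index Z \<rho> \<tau> X Y \<Lambda> \<epsilon>))"
proof -
  interpret ns_symnmf_run Z \<tau> \<rho> X Y \<Lambda> \<beta>
    using assms by unfold_locales
  obtain C0 where C0: "0 \<le> C0" and sum: "\<And>n. (\<Sum>t=1..n. opt t) \<le> C0 * lagr 1"
    using sum_opt_le by blast
  have L1: "0 \<le> lagr 1"
    by (rule lagr_nonneg) simp
  \<comment> \<open>\<open>2 * C0\<close> serves \<open>T \<ge> 2\<close>, the quotient serves
    \<open>T = 1\<close>, and 1 ensures positivity.\<close>
  define C where "C = 2 * C0 + 1 + \<bar>opt 0 / lagr 1\<bar>"
  have sum_lower: "real n * \<epsilon> \<le> C0 * lagr 1" if "\<And>t. t \<le> n \<Longrightarrow> \<epsilon> < opt t" for n \<epsilon>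
  proof -
    have "real n * \<epsilon> = (\<Sum>t=1..n. \<epsilon>)"
      by simp
    also have "\<dots> \<le> (\<Sum>t=1..n. opt t)"
      using that by (intro sum_mono) (simp add: less_imp_le)
    finally show ?thesis
      using sum[of n] by linarith
  qed
  have "(\<exists>t. opt t \<le> \<epsilon>) \<and> (iter_index Z \<rho> \<tau> X Y \<Lambda> \<epsilon> \<noteq> 0 \<and>
     (iter_index Z \<rho> \<tau> X Y \<Lambda> \<epsilon> = 1 \<longrightarrow> lagr 1 \<noteq> 0) \<longrightarrow>
     \<epsilon> \<le> C * lagr 1 / real (iter_index Z \<rho> \<tau> X Y \<Lambda> \<epsilon>))" if "0 < \<epsilon>" for \<epsilon>
  proof (intro conjI impI)
    show "\<exists>t. opt t \<le> \<epsilon>"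
    proof (rule ccontr)
      assume "\<not> (\<exists>t. opt t \<le> \<epsilon>)"
      then have "real n * \<epsilon> \<le> C0 * lagr 1" for n
        by (intro sum_lower) (simp add: not_le)
      moreover obtain n where "C0 * lagr 1 < real n * \<epsilon>"
        using reals_Archimedean3[OF \<open>0 < \<epsilon>\<close>] by blast
      ultimately show False
        by (meson not_le)
    qed
    define T where "T = iter_index Z \<rho> \<tau> X Y \<Lambda> \<epsilon>"
    assume "iter_index Z \<rho> \<tau> X Y \<Lambda> \<epsilon> \<noteq> 0 \<and> (iter_index Z \<rho> \<tau> X Y \<Lambda> \<epsilon> = 1 \<longrightarrow> lagr 1 \<noteq> 0)"
    then have T: "T \<noteq> 0" "T = 1 \<Longrightarrow> lagr 1 \<noteq> 0"
      by (auto simp: T_def)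
    have before: "\<epsilon> < opt t" if "t < T" for t
      using not_less_Least[OF that[unfolded T_def iter_index_def]] by simp
    have "\<epsilon> * real T \<le> C * lagr 1"
    \<comment> \<open>For \<open>T = 1\<close> only \<open>opt 0\<close> is known to exceed
      \<open>\<epsilon>\<close>, and iterate 0 lies outside the sum. For \<open>T \<ge> 2\<close>
      the sum covers \<open>T - 1\<close> iterates, and \<open>T \<le> 2 * (T - 1)\<close>.\<close>
    proof (cases "T = 1")
      case True
      then have "\<epsilon> \<le> opt 0"
        using before[of 0] by simp
      also have "\<dots> = opt 0 / lagr 1 * lagr 1"
        using T True by simp
      also have "\<dots> \<le> C * lagr 1"
        using L1 C0 abs_ge_self[of "opt 0 / lagr 1"] unfolding C_def
        by (intro mult_right_mono) linarith+
      finally show ?thesis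
        using True by simp
    next
      case False
      have "real (T - 1) * \<epsilon> \<le> C0 * lagr 1"
        using T(1) by (intro sum_lower before) auto
      moreover have "real T * \<epsilon> \<le> (2 * real (T - 1)) * \<epsilon>"
        using T(1) False \<open>0 < \<epsilon>\<close> by (intro mult_right_mono) auto
      ultimately have "\<epsilon> * real T \<le> 2 * C0 * lagr 1"
        by (simp add: mult_ac)
      also have "\<dots> \<le> C * lagr 1"
        using L1 by (intro mult_right_mono) (auto simp: C_def)
      finally show ?thesis .
    qed
    then show "\<epsilon> \<le> C * lagr 1 / real (iter_index Z \<rho> \<tau> X Y \<Lambda> \<epsilon>)"
      using T(1) unfolding T_def[symmetric] by (simp add: pos_le_divide_eq)
  qed
  moreover have "0 < C"
    using C0 unfolding C_def by linarith
  ultimately show ?thesis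
    by blast
qed

end
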